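(* Let $\alpha: I\subset\mathbb{R}\to\mathbb{E}^3$ be a unit speed curve with Frenet frame $\{T,N,B\}$ and type-2 Bishop frame $\{\zeta_1,\zeta_2,B\}$, and let $\theta: I\to\mathbb{R}$ be the angle function relating them, so that $$T=\sin\theta\,\zeta_1-\cos\theta\,\zeta_2,\qquad N=\cos\theta\,\zeta_1+\sin\theta\,\zeta_2 .$$ Let the spinors $\lambda$ and $\Psi$ represent the triads $\{\zeta_1,\zeta_2,B\}$ and $\{T,N,B\}$ respectively, i.e. $\overline{\lambda}^{\,t}\lambda=1$, $\overline{\Psi}^{\,t}\Psi=1$ and $$\zeta_1+i\zeta_2=\lambda^t\sigma\lambda,\quad B=-\hat\lambda^{\,t}\sigma\lambda,\qquad T+iN=\Psi^t\sigma\Psi,\quad B=-\hat\Psi^{\,t}\sigma\Psi .$$ Then $$\lambda^t\sigma\lambda=-i\,e^{i\theta}\,(\Psi^t\sigma\Psi),$$ while the binormal vector determined by the two spinors is the same: $-\hat\lambda^{\,t}\sigma\lambda=B=-\hat\Psi^{\,t}\sigma\Psi$.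
   Context: $\mathbb{E}^3$ is $\mathbb{R}^3$ with the standard flat metric. A spinor is a vector $\psi=\begin{pmatrix}\psi_1\\ \psi_2\end{pmatrix}\in\mathbb{C}^2$ (here depending on $s\in I$); $\overline{\psi}$ is its componentwise complex conjugate, the superscript $t$ denotes transposition, and the mate of $\psi$ is $\hat\psi=\begin{pmatrix}-\overline{\psi_2}\\ \overline{\psi_1}\end{pmatrix}$. The symbol $\sigma=(\sigma_1,\sigma_2,\sigma_3)$ denotes the triple of complex symmetric matrices $$\sigma_1=\begin{pmatrix}1&0\\0&-1\end{pmatrix},\quad \sigma_2=\begin{pmatrix}i&0\\0&i\end{pmatrix},\quad \sigma_3=\begin{pmatrix}0&-1\\-1&0\end{pmatrix},$$ and for spinors $\phi,\psi$ one writes $\phi^t\sigma\psi=(\phi^t\sigma_1\psi,\phi^t\sigma_2\psi,\phi^t\sigma_3\psi)\in\mathbb{C}^3$. The Frenet frame $\{T,N,B\}$ (unit tangent, normal, binormal), with curvature $\kappa$ and torsion $\tau$, satisfies $T'=\kappa N$, $N'=-\kappa T+\tau B$, $B'=-\tau N$. A type-2 Bishop frame along $\alpha$ is a positively oriented orthonormal frame $\{\zeta_1,\zeta_2,B\}$ satisfying $\zeta_1'=-\varepsilon_1B$, $\zeta_2'=-\varepsilon_2B$, $B'=\varepsilon_1\zeta_1+\varepsilon_2\zeta_2$ for real functions $\varepsilon_1,\varepsilon_2$ (the type-2 Bishop curvatures); the angle $\theta$ satisfies $\varepsilon_1=-\tau\cos\theta$, $\varepsilon_2=-\tau\sin\theta$,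 $\theta'=\kappa$. *)

theory Defs
  imports "HOL-Analysis.Analysis"
begin

type_synonym spinor = "complex^2"

(* The superscript t involves no conjugation, so phi^t psi is the bilinear
   scalar_product, not the Hermitian inner product. *)

definition sigma :: "complex^2^2^3" where
  "sigma = vector [vector [vector [1, 0], vector [0, -1]],
                   vector [vector [\<i>, 0], vector [0, \<i>]],
                   vector [vector [0, -1], vector [-1, 0]]]"

definition spinor_vec :: "spinor \<Rightarrow> spinor \<Rightarrow> complex^3" where
  "spinor_vec \<phi> \<psi> = (\<chi> k. scalar_product \<phi> (sigma $ k *v \<psi>))"

definition conj_spinor :: "spinor \<Rightarrow> spinor" where
  "conj_spinor \<psi> = (\<chi> j. cnj (\<psi> $ j))"

definition mate :: "spinor \<Rightarrow> spinor" where
  "mate \<psi> = vector [- cnj (\<psi> $ 2), cnj (\<psi> $ 1)]"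

definition cvec :: "real^3 \<Rightarrow> complex^3" where
  "cvec v = (\<chi> k. complex_of_real (v $ k))"

definition represents_triad :: "spinor \<Rightarrow> real^3 \<Rightarrow> real^3 \<Rightarrow> real^3 \<Rightarrow> bool" where
  "represents_triad \<psi> a b c \<longleftrightarrow>
     scalar_product (conj_spinor \<psi>) \<psi> = 1 \<and>
     cvec a + \<i> *s cvec b = spinor_vec \<psi> \<psi> \<and>
     cvec c = - spinor_vec (mate \<psi>) \<psi>"

definition pos_orthonormal_triad :: "real^3 \<Rightarrow> real^3 \<Rightarrow> real^3 \<Rightarrow> bool" where
  "pos_orthonormal_triad a b c \<longleftrightarrow>
     norm a = 1 \<and> norm b = 1 \<and> norm c = 1 \<and>
     a \<bullet> b = 0 \<and> a \<bullet> c = 0 \<and> b \<bullet> c = 0 \<and>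
     det (vector [a, b, c] :: real^3^3) > 0"

(* Derivatives are taken within I, hence are one-sided at endpoints belonging to I. *)

definition unit_speed_curve :: "real set \<Rightarrow> (real \<Rightarrow> real^3) \<Rightarrow> bool" where
  "unit_speed_curve I \<alpha> \<longleftrightarrow>
     is_interval I \<and> interior I \<noteq> {} \<and>
     (\<forall>s\<in>I. \<alpha> differentiable (at s within I) \<and>
            norm (vector_derivative \<alpha> (at s within I)) = 1)"

(* Since N s is a unit vector, kappa s > 0 and T' = kappa N force
   kappa = norm T' and N = T' / kappa, the usual curvature and principal normal. *)
definition frenet_frame ::
  "real set \<Rightarrow> (real \<Rightarrow> real^3) \<Rightarrow> (real \<Rightarrow> real^3) \<Rightarrow> (real \<Rightarrow> real^3) \<Rightarrow> (real \<Rightarrow> real^3)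
     \<Rightarrow> (real \<Rightarrow> real) \<Rightarrow> (real \<Rightarrow> real) \<Rightarrow> bool" where
  "frenet_frame I \<alpha> T N B \<kappa> \<tau> \<longleftrightarrow>
     (\<forall>s\<in>I. pos_orthonormal_triad (T s) (N s) (B s) \<and> \<kappa> s > 0 \<and>
        (\<alpha> has_vector_derivative T s) (at s within I) \<and>
        (T has_vector_derivative \<kappa> s *\<^sub>R N s) (at s within I) \<and>
        (N has_vector_derivative - \<kappa> s *\<^sub>R T s + \<tau> s *\<^sub>R B s) (at s within I) \<and>
        (B has_vector_derivative - \<tau> s *\<^sub>R N s) (at s within I))"

definition type2_bishop_frame ::
  "real set \<Rightarrow> (real \<Rightarrow> real^3) \<Rightarrow> (real \<Rightarrow> real^3) \<Rightarrow> (real \<Rightarrow> real^3)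
     \<Rightarrow> (real \<Rightarrow> real) \<Rightarrow> (real \<Rightarrow> real) \<Rightarrow> bool" where
  "type2_bishop_frame I \<zeta>1 \<zeta>2 B \<epsilon>1 \<epsilon>2 \<longleftrightarrow>
     (\<forall>s\<in>I. pos_orthonormal_triad (\<zeta>1 s) (\<zeta>2 s) (B s) \<and>
        (\<zeta>1 has_vector_derivative - \<epsilon>1 s *\<^sub>R B s) (at s within I) \<and>
        (\<zeta>2 has_vector_derivative - \<epsilon>2 s *\<^sub>R B s) (at s within I) \<and>
        (B has_vector_derivative \<epsilon>1 s *\<^sub>R \<zeta>1 s + \<epsilon>2 s *\<^sub>R \<zeta>2 s) (at s within I))"

definition bishop_angle ::
  "real set \<Rightarrow> (real \<Rightarrow> real) \<Rightarrow> (real \<Rightarrow> real) \<Rightarrow> (real \<Rightarrow> real) \<Rightarrow> (real \<Rightarrow> real)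
     \<Rightarrow> (real \<Rightarrow> real) \<Rightarrow> bool" where
  "bishop_angle I \<kappa> \<tau> \<epsilon>1 \<epsilon>2 \<theta> \<longleftrightarrow>
     (\<forall>s\<in>I. \<epsilon>1 s = - \<tau> s * cos (\<theta> s) \<and> \<epsilon>2 s = - \<tau> s * sin (\<theta> s) \<and>
        (\<theta> has_real_derivative \<kappa> s) (at s within I))"

end

theory Submission
  imports Defs
begin

text \<open>A rotation of an orthonormal pair in its own plane acts on the isotropic vector
  \<open>u + \<i> v\<close> as multiplication by a unit complex number. Expanding with the given
  relations, \<open>T + \<i> N = \<i> e^(-\<i>\<theta>) (\<zeta>1 + \<i> \<zeta>2)\<close>;
  inverting the phase gives the factor \<open>-\<i> e^(\<i>\<theta>)\<close>.
  \<open>complexified_frame_rotation\<close> is this identity for arbitrary real vectors, and the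
  spinor formula is its translation through \<open>represents_triad\<close>. Both triads have the
  same third vector \<open>B\<close>, which gives the binormal equalities.\<close>

lemma complexified_frame_rotation:
  fixes u v :: "real^3" and t :: real
  shows "cvec u + \<i> *s cvec v =
    (- \<i> * exp (\<i> * complex_of_real t)) *s
      (cvec (sin t *\<^sub>R u - cos t *\<^sub>R v) + \<i> *s cvec (cos t *\<^sub>R u + sin t *\<^sub>R v))"
proof -
  \<comment> \<open>The nested products match the shape left by \<open>algebra_simps\<close>; this
    collapses the squared terms in each coordinate, while the mixed
    \<open>sin\<close>-\<open>cos\<close> terms cancel.\<close>
  have pyth: "cos t * (cos t * x) + sin t * (sin t * x) = x" for x :: real
    by (simp add: mult.assoc[symmetric] distrib_right[symmetric] power2_eq_square[symmetric])
  \<comment> \<open>Splitting the phase into real and imaginary parts reduces the claim to two real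
    identities per coordinate.\<close>
  have "exp (\<i> * complex_of_real t) = Complex (cos t) (sin t)"
    by (simp add: exp_Euler complex_eq_iff cos_of_real sin_of_real)
  then show ?thesis
    by (simp add: vec_eq_iff cvec_def complex_eq_iff algebra_simps pyth)
qed

theorem theorem4:
  fixes I :: "real set"
    and \<alpha> T N B \<zeta>1 \<zeta>2 :: "real \<Rightarrow> real^3"
    and \<kappa> \<tau> \<epsilon>1 \<epsilon>2 \<theta> :: "real \<Rightarrow> real"
    and lam \<Psi> :: "real \<Rightarrow> spinor"
  assumes "unit_speed_curve I \<alpha>"
    and "frenet_frame I \<alpha> T N B \<kappa> \<tau>"
    and "type2_bishop_frame I \<zeta>1 \<zeta>2 B \<epsilon>1 \<epsilon>2"
    and "bishop_angle I \<kappa> \<tau> \<epsilon>1 \<epsilon>2 \<theta>"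
    and "\<forall>s\<in>I. T s = sin (\<theta> s) *\<^sub>R \<zeta>1 s - cos (\<theta> s) *\<^sub>R \<zeta>2 s"
    and "\<forall>s\<in>I. N s = cos (\<theta> s) *\<^sub>R \<zeta>1 s + sin (\<theta> s) *\<^sub>R \<zeta>2 s"
    and "\<forall>s\<in>I. represents_triad (lam s) (\<zeta>1 s) (\<zeta>2 s) (B s)"
    and "\<forall>s\<in>I. represents_triad (\<Psi> s) (T s) (N s) (B s)"
  shows "\<forall>s\<in>I.
      spinor_vec (lam s) (lam s)
        = (- \<i> * exp (\<i> * complex_of_real (\<theta> s))) *s spinor_vec (\<Psi> s) (\<Psi> s) \<and>
      - spinor_vec (mate (lam s)) (lam s) = cvec (B s) \<and>
      cvec (B s) = - spinor_vec (mate (\<Psi> s)) (\<Psi> s)"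
proof
  fix s assume s: "s \<in> I"
  have lam: "spinor_vec (lam s) (lam s) = cvec (\<zeta>1 s) + \<i> *s cvec (\<zeta>2 s)"
      "cvec (B s) = - spinor_vec (mate (lam s)) (lam s)"
    and \<Psi>: "spinor_vec (\<Psi> s) (\<Psi> s) = cvec (T s) + \<i> *s cvec (N s)"
      "cvec (B s) = - spinor_vec (mate (\<Psi> s)) (\<Psi> s)"
    using assms(7,8) s by (simp_all add: represents_triad_def)
  \<comment> \<open>With \<open>u = \<zeta>1 s\<close>, \<open>v = \<zeta>2 s\<close> and
    \<open>t = \<theta> s\<close>, the two combinations on the right of the rotation identity are
    exactly \<open>T s\<close> and \<open>N s\<close>.\<close>
  have "spinor_vec (lam s) (lam s)
      = (- \<i> * exp (\<i> * complex_of_real (\<theta> s))) *s spinor_vec (\<Psi> s) (\<Psi> s)"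
    using assms(5,6) s complexified_frame_rotation[of "\<zeta>1 s" "\<zeta>2 s" "\<theta> s"]
    unfolding lam(1) \<Psi>(1) by simp
  then show "spinor_vec (lam s) (lam s)
        = (- \<i> * exp (\<i> * complex_of_real (\<theta> s))) *s spinor_vec (\<Psi> s) (\<Psi> s) \<and>
      - spinor_vec (mate (lam s)) (lam s) = cvec (B s) \<and>
      cvec (B s) = - spinor_vec (mate (\<Psi> s)) (\<Psi> s)"
    using lam(2) \<Psi>(2) by simp
qed

end
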